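(* Let $V$ be a finite-dimensional vector space over a field $F$, and let $Q\colon V\to F$ and $\tilde Q\colon F\times V^*\to F$ be quadratic forms such that $\mathrm{O}'(F\times V^*,\tilde Q)$ induces the same collineation group on the projective space $\mathbb P(F\times V^* )$ as one of the groups $\mathrm{AO}(V,Q)^\beta$ or $\mathrm{AO}'(V,Q)^\beta$. Then $$\mathrm{AO}(V,Q)^\beta=\mathrm{O}'(F\times V^*,\tilde Q),$$ unless $\dim V=0$, $\operatorname{Char}F\neq 2$ and $\tilde Q(F\times V^* )\neq\{0\}$ all hold.
   Context: $F$ is an arbitrary (commutative) field, $F^\times=F\setminus\{0\}$. $V^*$ is the dual of $V$ with canonical pairing $\langle\cdot,\cdot\rangle$. For a linear map $\eta$, $\eta^{\mathrm T}\colon a^*\mapsto a^*\circ\eta$ is its transpose. For a quadratic form $Q$ on $V$: polar form $B(x,y)=Q(x+y)-Q(x)-Q(y)$; radical $V^\perp=\{x\in V\mid B(x,y)=0\ \forall y\in V\}$. $\mathrm{O}(V,Q)=\{\varphi\in\mathrm{GL}(V)\mid Q\circ\varphi=Q\}$ is the orthogonal group; the weak orthogonal group $\mathrm{O}'(V,Q)$ is the subgroup of those $\varphi\in\mathrm{O}(V,Q)$ fixing every vector of $V^\perp$. The same notions apply to quadratic forms on $F\times V^*$. $\mathrm{AGL}(V)$ is the group of all affinities $\gamma\colon V\to V$, $\gamma(x)=t+\gamma_+(x)$ with (unique) $\gamma_+\in\mathrm{GL}(V)$, $t\in V$. The motion group $\mathrm{AO}(V,Q)$ (resp. weak motion group $\mathrm{AO}'(V,Q)$)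 consists of all $\gamma\in\mathrm{AGL}(V)$ with $\gamma_+\in\mathrm{O}(V,Q)$ (resp. $\gamma_+\in\mathrm{O}'(V,Q)$) and arbitrary $t$. $\beta\colon\mathrm{AGL}(V)\to\mathrm{GL}(F\times V^* )$, $\gamma\mapsto\gamma^\beta$, is the faithful linear representation given by $$\gamma^\beta(a_0,a^* )=\Bigl(a_0-\bigl\langle(\gamma_+^{\mathrm T})^{-1}(a^* ),t\bigr\rangle,\ (\gamma_+^{\mathrm T})^{-1}(a^* )\Bigr).$$ For a subgroup $G\leq\mathrm{AGL}(V)$, $G^\beta$ denotes its image under $\beta$. The projective space $\mathbb P(F\times V^* )$ is the set of all subspaces of $F\times V^*$; each $\kappa\in\mathrm{GL}(F\times V^* )$ induces the projective collineation $X\mapsto\kappa(X)$ on it, and the kernel of this action is $F^\times\,\mathrm{id}_{F\times V^*}$. The collineation group induced by a subgroup of $\mathrm{GL}(F\times V^* )$ is its image under this action. *)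

theory Defs
  imports
    "HOL-Library.Function_Algebras"
    "HOL-Library.Product_Plus"
    "HOL-Library.FuncSet"
    "HOL-Computational_Algebra.Computational_Algebra"
begin

section \<open>Linear groups on a carrier subspace\<close>

text \<open>
  All notions for vector spaces with a quadratic form are stated for a subspace \<open>W\<close> of a
  vector space with scalar multiplication \<open>s\<close>, since they are applied both to \<open>V\<close>
  (a full type, \<open>W = UNIV\<close>) and to \<open>F \<times> V\<^sup>*\<close>, which is a subspace of
  \<open>F \<times> (V \<Rightarrow> F)\<close>. Self-maps of \<open>W\<close> are represented by functions in
  \<open>extensional W\<close>, so that equality of such functions is equality as maps on \<open>W\<close>;
  for \<open>W = UNIV\<close> this is no restriction.
\<close>

definition GL :: "('a::field \<Rightarrow> 'b::ab_group_add \<Rightarrow> 'b) \<Rightarrow> 'b set \<Rightarrow> ('b \<Rightarrow> 'b) set" where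
  "GL s W = {\<phi> \<in> extensional W. bij_betw \<phi> W W \<and>
     (\<forall>x\<in>W. \<forall>y\<in>W. \<phi> (x + y) = \<phi> x + \<phi> y) \<and>
     (\<forall>c. \<forall>x\<in>W. \<phi> (s c x) = s c (\<phi> x))}"

definition polar :: "('b::ab_group_add \<Rightarrow> 'a::field) \<Rightarrow> 'b \<Rightarrow> 'b \<Rightarrow> 'a" where
  "polar Q x y = Q (x + y) - Q x - Q y"

text \<open>The polar form is symmetric, so linearity in the first argument makes it bilinear.\<close>

definition quadratic_form ::
  "('a::field \<Rightarrow> 'b::ab_group_add \<Rightarrow> 'b) \<Rightarrow> 'b set \<Rightarrow> ('b \<Rightarrow> 'a) \<Rightarrow> bool" where
  "quadratic_form s W Q \<longleftrightarrow>
     (\<forall>c. \<forall>x\<in>W. Q (s c x) = c\<^sup>2 * Q x) \<and>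
     (\<forall>x\<in>W. \<forall>y\<in>W. \<forall>z\<in>W. polar Q (x + y) z = polar Q x z + polar Q y z) \<and>
     (\<forall>c. \<forall>x\<in>W. \<forall>z\<in>W. polar Q (s c x) z = c * polar Q x z)"

definition radical :: "'b::ab_group_add set \<Rightarrow> ('b \<Rightarrow> 'a::field) \<Rightarrow> 'b set" where
  "radical W Q = {x \<in> W. \<forall>y\<in>W. polar Q x y = 0}"

definition orthogonal_group ::
  "('a::field \<Rightarrow> 'b::ab_group_add \<Rightarrow> 'b) \<Rightarrow> 'b set \<Rightarrow> ('b \<Rightarrow> 'a) \<Rightarrow> ('b \<Rightarrow> 'b) set" where
  "orthogonal_group s W Q = {\<phi> \<in> GL s W. \<forall>x\<in>W. Q (\<phi> x) = Q x}"

definition weak_orthogonal_group ::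
  "('a::field \<Rightarrow> 'b::ab_group_add \<Rightarrow> 'b) \<Rightarrow> 'b set \<Rightarrow> ('b \<Rightarrow> 'a) \<Rightarrow> ('b \<Rightarrow> 'b) set" where
  "weak_orthogonal_group s W Q =
     {\<phi> \<in> orthogonal_group s W Q. \<forall>x\<in>radical W Q. \<phi> x = x}"


section \<open>Affinities and motions\<close>

definition AGL :: "('a::field \<Rightarrow> 'b::ab_group_add \<Rightarrow> 'b) \<Rightarrow> ('b \<Rightarrow> 'b) set" where
  "AGL s = {\<gamma>. \<exists>t. \<exists>\<phi>\<in>GL s UNIV. \<forall>x. \<gamma> x = t + \<phi> x}"

definition trans_part :: "('b::ab_group_add \<Rightarrow> 'b) \<Rightarrow> 'b" where
  "trans_part \<gamma> = \<gamma> 0"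

definition linear_part :: "('b::ab_group_add \<Rightarrow> 'b) \<Rightarrow> 'b \<Rightarrow> 'b" where
  "linear_part \<gamma> = (\<lambda>x. \<gamma> x - \<gamma> 0)"

lemma affinity_parts:
  assumes "\<phi> \<in> GL s UNIV" and "\<And>x. \<gamma> x = t + \<phi> x"
  shows "trans_part \<gamma> = t" and "linear_part \<gamma> = \<phi>"
proof -
  have "\<phi> (0 + 0) = \<phi> 0 + \<phi> 0"
    using assms(1) unfolding GL_def by blast
  hence "\<phi> 0 = 0" by simp
  thus "trans_part \<gamma> = t" "linear_part \<gamma> = \<phi>"
    by (simp_all add: trans_part_def linear_part_def assms(2) fun_eq_iff)
qed

definition motion_group ::
  "('a::field \<Rightarrow> 'b::ab_group_add \<Rightarrow> 'b) \<Rightarrow> ('b \<Rightarrow> 'a) \<Rightarrow> ('b \<Rightarrow> 'b) set" where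
  "motion_group s Q = {\<gamma> \<in> AGL s. linear_part \<gamma> \<in> orthogonal_group s UNIV Q}"

definition weak_motion_group ::
  "('a::field \<Rightarrow> 'b::ab_group_add \<Rightarrow> 'b) \<Rightarrow> ('b \<Rightarrow> 'a) \<Rightarrow> ('b \<Rightarrow> 'b) set" where
  "weak_motion_group s Q = {\<gamma> \<in> AGL s. linear_part \<gamma> \<in> weak_orthogonal_group s UNIV Q}"


section \<open>The dual space and the representation on \<open>F \<times> V\<^sup>*\<close>\<close>

definition dual :: "('a::field \<Rightarrow> 'b::ab_group_add \<Rightarrow> 'b) \<Rightarrow> ('b \<Rightarrow> 'a) set" where
  "dual s = {f. Vector_Spaces.linear s (*) f}"

definition transp :: "('b \<Rightarrow> 'b) \<Rightarrow> ('b \<Rightarrow> 'a) \<Rightarrow> ('b \<Rightarrow> 'a)" where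
  "transp \<eta> = (\<lambda>a. a \<circ> \<eta>)"

definition FxDual :: "('a::field \<Rightarrow> 'b::ab_group_add \<Rightarrow> 'b) \<Rightarrow> ('a \<times> ('b \<Rightarrow> 'a)) set" where
  "FxDual s = UNIV \<times> dual s"

definition FxDual_scale ::
  "'a::field \<Rightarrow> 'a \<times> ('b::ab_group_add \<Rightarrow> 'a) \<Rightarrow> 'a \<times> ('b \<Rightarrow> 'a)" where
  "FxDual_scale c p = (c * fst p, \<lambda>x. c * snd p x)"

definition beta ::
  "('a::field \<Rightarrow> 'b::ab_group_add \<Rightarrow> 'b) \<Rightarrow> ('b \<Rightarrow> 'b)
     \<Rightarrow> ('a \<times> ('b \<Rightarrow> 'a) \<Rightarrow> 'a \<times> ('b \<Rightarrow> 'a))" where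
  "beta s \<gamma> = (\<lambda>(a\<^sub>0, a) \<in> FxDual s.
     let b = inv_into (dual s) (transp (linear_part \<gamma>)) a
     in (a\<^sub>0 - b (trans_part \<gamma>), b))"

lemma vector_space_FxDual_scale:
  "vector_space (FxDual_scale :: 'a::field \<Rightarrow> 'a \<times> ('b::ab_group_add \<Rightarrow> 'a) \<Rightarrow> _)"
  by unfold_locales (auto simp: FxDual_scale_def fun_eq_iff algebra_simps)

lemma dual_iff:
  assumes "vector_space s"
  shows "f \<in> dual s \<longleftrightarrow> (\<forall>x y. f (x + y) = f x + f y) \<and> (\<forall>c x. f (s c x) = c * f x)"
  using assms by (auto simp: dual_def linear_iff_module_hom module_hom_iff
      vector_space_def module_def algebra_simps)

lemma subspace_FxDual:
  assumes "vector_space s"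
  shows "module.subspace FxDual_scale (FxDual s)"
proof -
  interpret D: vector_space FxDual_scale by (rule vector_space_FxDual_scale)
  show ?thesis
    by (auto simp: D.subspace_def FxDual_def FxDual_scale_def dual_iff[OF assms] algebra_simps
        zero_prod_def)
qed

lemma bij_betw_transp:
  assumes "vector_space s" "\<phi> \<in> GL s UNIV"
  shows "bij_betw (transp \<phi>) (dual s) (dual s)"
proof -
  have bij: "bij \<phi>" and add: "\<phi> (x + y) = \<phi> x + \<phi> y" and sc: "\<phi> (s c x) = s c (\<phi> x)" for c x y
    using assms(2) by (auto simp: GL_def)
  have inv: "inv \<phi> (\<phi> x) = x" "\<phi> (inv \<phi> x) = x" for x
    using bij by (simp_all add: bij_is_inj bij_is_surj surj_f_inv_f)
  have add': "inv \<phi> (x + y) = inv \<phi> x + inv \<phi> y" for x y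
    by (metis add inv)
  have sc': "inv \<phi> (s c x) = s c (inv \<phi> x)" for c x
    by (metis sc inv)
  show ?thesis
    by (rule bij_betw_byWitness[where f' = "transp (inv \<phi>)"])
      (auto simp: transp_def dual_iff[OF assms(1)] fun_eq_iff inv add sc add' sc')
qed


section \<open>Collineations of \<open>P(F \<times> V\<^sup>*)\<close>\<close>

definition proj_space ::
  "('a::field \<Rightarrow> 'b::ab_group_add \<Rightarrow> 'b) \<Rightarrow> 'b set \<Rightarrow> 'b set set" where
  "proj_space s W = {X. module.subspace s X \<and> X \<subseteq> W}"

definition collineation ::
  "('a::field \<Rightarrow> 'b::ab_group_add \<Rightarrow> 'b) \<Rightarrow> 'b set \<Rightarrow> ('b \<Rightarrow> 'b) \<Rightarrow> 'b set \<Rightarrow> 'b set" where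
  "collineation s W \<kappa> = (\<lambda>X \<in> proj_space s W. \<kappa> ` X)"

definition induced_collineations ::
  "('a::field \<Rightarrow> 'b::ab_group_add \<Rightarrow> 'b) \<Rightarrow> 'b set \<Rightarrow> ('b \<Rightarrow> 'b) set \<Rightarrow> ('b set \<Rightarrow> 'b set) set" where
  "induced_collineations s W G = collineation s W ` G"

end

theory Submission
  imports Defs
begin

text \<open>
  Write \<open>W = F \<times> V\<^sup>*\<close>, \<open>e = (1, 0)\<close>, \<open>H = O'(W, Q')\<close> and let \<open>G\<close> be whichever of the two
  represented motion groups has the same collineations as \<open>H\<close>. A vector \<open>(a\<^sub>0, a)\<close> stands for
  the affine function \<open>a\<^sub>0 + a\<close> on \<open>V\<close>, and \<open>e\<close> for the constant functions, so
  every element of \<open>G\<close> fixes \<open>e\<close>. Equal collineations mean equality up to a scalar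
  (\<open>GL_collineation_eq_imp_scalar\<close>), and the proof has two tasks: to show that the scalars are
  all \<open>1\<close>, and to show that the weak motion group can be the right one only if it is the full one.

  \<^bold>\<open>The scalars.\<close> Both motion groups contain all translations, which act on \<open>W\<close> as the
  transvections \<open>(a\<^sub>0, a) \<mapsto> (a\<^sub>0 - a t, a)\<close>. Hence each of these preserves \<open>Q'\<close> up to a constant
  factor, which is a strong restriction on \<open>e\<close>. If \<open>Q' e = 0\<close>, then \<open>e\<close> lies in the
  radical (\<open>singular_apex_in_radical\<close>), so \<open>H\<close> fixes it. If \<open>Q' e \<noteq> 0\<close>, then the characteristic
  is \<open>2\<close>, by \<open>nonsingular_apex\<close> when \<open>V \<noteq> 0\<close> and by the excluded exception when \<open>V = 0\<close>;
  a scalar \<open>c\<close> with \<open>c\<^sup>2 Q' e = Q' e\<close> is then \<open>1\<close>. In both cases \<open>H = G\<close>.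

  \<^bold>\<open>Weak versus full.\<close> Suppose that \<open>H\<close> is the image of the weak motion group. If
  \<open>Q' e \<noteq> 0\<close>, then \<open>V\<close> has at most one nonzero vector (\<open>nonsingular_apex_small\<close>) and
  \<open>GL(V)\<close> is trivial. If \<open>Q' e = 0\<close>, the radical of \<open>Q'\<close> is exactly the line \<open>F e\<close>, because
  it is fixed by all translations, so \<open>Q'\<close> induces a nondegenerate form on \<open>V\<^sup>*\<close>, whose
  reflections all belong to \<open>H\<close> and thus fix the radical of \<open>Q\<close> vectorwise in their action
  on \<open>V\<close>. A nondegenerate form has too many reflections for that
  (\<open>weak_motions_imp_nondegenerate\<close>), so the radical of \<open>Q\<close> is \<open>0\<close> and \<open>O'(V, Q) = O(V, Q)\<close>.
\<close>

section \<open>Quadratic forms on a subspace\<close>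

locale quadratic_subspace = vector_space s
  for s :: "'a::field \<Rightarrow> 'b::ab_group_add \<Rightarrow> 'b" +
  fixes W :: "'b set" and q :: "'b \<Rightarrow> 'a"
  assumes subspace_W: "subspace W"
    and form: "quadratic_form s W q"
begin

lemma in_W [intro, simp]:
  "0 \<in> W" "x \<in> W \<Longrightarrow> y \<in> W \<Longrightarrow> x + y \<in> W" "x \<in> W \<Longrightarrow> y \<in> W \<Longrightarrow> x - y \<in> W" "x \<in> W \<Longrightarrow> s c x \<in> W"
  using subspace_W by (auto intro: subspace_0 subspace_add subspace_diff subspace_scale)

lemma form_scale: "x \<in> W \<Longrightarrow> q (s c x) = c\<^sup>2 * q x"
  using form by (simp add: quadratic_form_def)

lemma form_add: "q (x + y) = q x + q y + polar q x y"
  by (simp add: polar_def)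

lemma polar_commute: "polar q x y = polar q y x"
  by (simp add: polar_def add.commute)

lemma polar_add_left: "x \<in> W \<Longrightarrow> y \<in> W \<Longrightarrow> z \<in> W \<Longrightarrow> polar q (x + y) z = polar q x z + polar q y z"
  using form by (simp add: quadratic_form_def)

lemma polar_scale_left: "x \<in> W \<Longrightarrow> z \<in> W \<Longrightarrow> polar q (s c x) z = c * polar q x z"
  using form by (simp add: quadratic_form_def)

lemma polar_add_right: "x \<in> W \<Longrightarrow> y \<in> W \<Longrightarrow> z \<in> W \<Longrightarrow> polar q z (x + y) = polar q z x + polar q z y"
  using polar_add_left polar_commute by metis

lemma polar_scale_right: "x \<in> W \<Longrightarrow> z \<in> W \<Longrightarrow> polar q z (s c x) = c * polar q z x"
  using polar_scale_left polar_commute by metis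

lemma polar_self: "x \<in> W \<Longrightarrow> polar q x x = 2 * q x"
  using form_scale[of x 2] scale_left_distrib[of 1 1 x] by (simp add: polar_def)

text \<open>
  Restricted to \<open>W\<close> because the groups consist of extensional functions. The scalar is
  written inside \<open>s\<close>, as \<open>x + s (-c) u\<close>, so that the additive rules for \<open>q\<close> and \<open>polar q\<close> apply.
\<close>
definition reflection :: "'b \<Rightarrow> 'b \<Rightarrow> 'b" where
  "reflection u = (\<lambda>x\<in>W. x + s (- (polar q x u / q u)) u)"

text \<open>
  Bijectivity holds because a reflection is an involution, which in turn rests on
  \<open>polar q u u = 2 * q u\<close>; the argument is uniform in the characteristic.
\<close>
lemma reflection_weak_orthogonal:
  assumes u: "u \<in> W" "q u \<noteq> 0"
  shows "reflection u \<in> weak_orthogonal_group s W q"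
proof -
  let ?r = "\<lambda>x. x + s (- (polar q x u / q u)) u"
  have inv: "?r (?r x) = x" if "x \<in> W" for x
  proof -
    have "polar q (?r x) u = - polar q x u"
      using that u by (simp add: polar_add_left polar_scale_left polar_self del: scale_minus_left)
    thus ?thesis by simp
  qed
  have rW: "?r x \<in> W" if "x \<in> W" for x using that u by simp
  have bij: "bij_betw ?r W W"
    by (rule bij_betw_byWitness[where f' = ?r]) (use inv rW in blast)+
  have add: "?r (x + y) = ?r x + ?r y" if "x \<in> W" "y \<in> W" for x y
    using that u by (simp add: polar_add_left add_divide_distrib scale_left_distrib scale_left_diff_distrib)
  have sc: "?r (s c x) = s c (?r x)" if "x \<in> W" for c x
    using that u by (simp add: polar_scale_left scale_right_diff_distrib)
  have iso: "q (?r x) = q x" if "x \<in> W" for x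
  proof -
    have "q (?r x) = q x + (polar q x u / q u)\<^sup>2 * q u - polar q x u / q u * polar q x u"
      using that u by (simp add: form_add form_scale polar_scale_right del: scale_minus_left)
    thus ?thesis using u by (simp add: power2_eq_square)
  qed
  have fix_rad: "?r x = x" if "x \<in> radical W q" for x
    using that u by (simp add: radical_def)
  have R: "reflection u x = ?r x" if "x \<in> W" for x
    using that by (simp add: reflection_def)
  have "bij_betw (reflection u) W W"
    using bij bij_betw_cong[of W "reflection u" ?r W, OF R] by blast
  moreover have "reflection u \<in> extensional W" by (simp add: reflection_def)
  moreover have "reflection u (x + y) = reflection u x + reflection u y" if "x \<in> W" "y \<in> W" for x y
    unfolding R[OF that(1)] R[OF that(2)] R[OF in_W(2)[OF that]] by (rule add[OF that])
  moreover have "reflection u (s c x) = s c (reflection u x)" if "x \<in> W" for c x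
    unfolding R[OF that] R[OF in_W(4)[OF that]] by (rule sc[OF that])
  moreover have "q (reflection u x) = q x" if "x \<in> W" for x
    unfolding R[OF that] by (rule iso[OF that])
  moreover have "reflection u x = x" if x: "x \<in> radical W q" for x
  proof -
    have "x \<in> W" using x by (simp add: radical_def)
    from R[OF this] fix_rad[OF x] show ?thesis by (rule trans)
  qed
  ultimately show ?thesis
    unfolding weak_orthogonal_group_def orthogonal_group_def GL_def by blast
qed

end

section \<open>Linear maps inducing the same collineation\<close>

text \<open>
  On lines the hypothesis says \<open>f x = c\<^sub>x g x\<close>. Comparing the factors at \<open>x\<close>, \<open>y\<close> and \<open>x + y\<close> gives
  equal factors when \<open>g x\<close> and \<open>g y\<close> are independent; when they are dependent, so are \<open>x\<close> and \<open>y\<close>,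
  and linearity carries the factor of \<open>x\<close> over to \<open>y\<close>.
\<close>
lemma (in vector_space) GL_collineation_eq_imp_scalar:
  assumes W: "subspace W" and f: "f \<in> GL scale W" and g: "g \<in> GL scale W"
    and eq: "collineation scale W f = collineation scale W g"
  shows "\<exists>c. c \<noteq> 0 \<and> (\<forall>x\<in>W. f x = scale c (g x))"
proof -
  have fadd: "f (x + y) = f x + f y" and gadd: "g (x + y) = g x + g y"
    if "x \<in> W" "y \<in> W" for x y using f g that by (auto simp: GL_def)
  have fsc: "f (scale c x) = scale c (f x)" and gsc: "g (scale c x) = scale c (g x)"
    if "x \<in> W" for c x using f g that by (auto simp: GL_def)
  have 0: "0 \<in> W" using W by (rule subspace_0)
  have injg: "inj_on g W" and injf: "inj_on f W" using f g by (auto simp: GL_def bij_betw_def)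
  have f0: "f 0 = 0" using fadd[OF 0 0] by simp
  have pt: "\<exists>c. f x = scale c (g x)" if "x \<in> W" for x
  proof -
    have X: "span {x} \<in> proj_space scale W"
      using that W by (auto simp: proj_space_def span_minimal)
    hence "f ` span {x} = g ` span {x}"
      using fun_cong[OF eq, of "span {x}"] by (simp add: collineation_def)
    hence "f x \<in> g ` span {x}" using span_base[of x "{x}"] by blast
    thus ?thesis using that by (auto simp: span_singleton gsc)
  qed
  show ?thesis
  proof (cases "W = {0}")
    case True
    hence "\<forall>x\<in>W. f x = scale 1 (g x)" using pt[OF 0] gsc[OF 0, of 0] f0 by auto
    thus ?thesis by (intro exI[of _ 1]) auto
  next
    case False
    then obtain x where x: "x \<in> W" "x \<noteq> 0" using 0 by blast
    obtain c where c: "f x = scale c (g x)" using pt x by blast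
    have "f x \<noteq> 0" using injf x 0 f0 by (metis inj_onD)
    hence c0: "c \<noteq> 0" and gx: "g x \<noteq> 0" using c by auto
    have "f y = scale c (g y)" if y: "y \<in> W" for y
    proof -
      obtain d where d: "f y = scale d (g y)" using pt y by blast
      obtain k where "f (x + y) = scale k (g (x + y))" using pt y x W subspace_add by blast
      hence k: "scale (k - d) (g y) = scale (c - k) (g x)"
        using fadd gadd x y c d by (simp add: algebra_simps)
      show ?thesis
      proof (cases "k = d")
        case True
        thus ?thesis using k gx d by simp
      next
        case False
        hence "g y = scale (1 / (k - d)) (scale (k - d) (g y))" by simp
        also have "\<dots> = g (scale ((c - k) / (k - d)) x)"
          unfolding k using x gsc by simp
        finally have "y = scale ((c - k) / (k - d)) x"
          using inj_onD[OF injg] x y subspace_scale[OF W] by simp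
        thus ?thesis using fsc gsc x c by (simp add: mult.commute)
      qed
    qed
    thus ?thesis using c0 by blast
  qed
qed

section \<open>The representation on \<open>F \<times> V\<^sup>*\<close>\<close>

context vector_space
begin

lemma dual_add: "a \<in> dual scale \<Longrightarrow> a (x + y) = a x + a y"
  and dual_scale: "a \<in> dual scale \<Longrightarrow> a (scale c x) = c * a x"
  and dual_0: "a \<in> dual scale \<Longrightarrow> a 0 = 0"
  and dual_diff: "a \<in> dual scale \<Longrightarrow> a (x - y) = a x - a y"
proof -
  assume a: "a \<in> dual scale"
  show add: "a (x + y) = a x + a y" for x y
    using a by (auto simp: dual_iff[OF vector_space_axioms])
  show "a (scale c x) = c * a x"
    using a by (auto simp: dual_iff[OF vector_space_axioms])
  show "a 0 = 0" using a dual_iff[OF vector_space_axioms, of a] scale_zero_left mult_zero_left by metis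
  show "a (x - y) = a x - a y" using add[of "x - y" y] by (simp add: algebra_simps)
qed

lemma dual_separates:
  assumes "v \<noteq> 0"
  obtains a where "a \<in> dual scale" "a v = 1"
proof -
  interpret F: vector_space "(*) :: 'a \<Rightarrow> 'a \<Rightarrow> 'a"
    by unfold_locales (auto simp: algebra_simps)
  interpret VF: vector_space_pair scale "(*) :: 'a \<Rightarrow> 'a \<Rightarrow> 'a" ..
  have "independent {v}" using assms by (simp add: dependent_single)
  from VF.linear_independent_extend[OF this, of "\<lambda>_. 1"] show ?thesis
    using that by (auto simp: dual_def)
qed

lemma dual_separatesD:
  assumes "\<And>a. a \<in> dual scale \<Longrightarrow> a v = a w"
  shows "v = w"
proof (rule ccontr)
  assume "v \<noteq> w"
  then obtain a where a: "a \<in> dual scale" "a (v - w) = 1" using dual_separates[of "v - w"] by auto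
  thus False using assms[OF a(1)] dual_diff[OF a(1), of v w] by simp
qed

lemma inv_GL:
  assumes "\<phi> \<in> GL scale UNIV"
  shows "inv \<phi> (\<phi> x) = x" "\<phi> (inv \<phi> x) = x"
    "a \<in> dual scale \<Longrightarrow> a \<circ> inv \<phi> \<in> dual scale" "a \<in> dual scale \<Longrightarrow> a \<circ> \<phi> \<in> dual scale"
proof -
  have bij: "bij \<phi>" and add: "\<phi> (x + y) = \<phi> x + \<phi> y" and sc: "\<phi> (scale c x) = scale c (\<phi> x)"
    for c x y using assms by (auto simp: GL_def)
  show inv: "inv \<phi> (\<phi> x) = x" "\<phi> (inv \<phi> x) = x" for x
    using bij by (simp_all add: bij_is_inj bij_is_surj surj_f_inv_f)
  have "inv \<phi> (x + y) = inv \<phi> x + inv \<phi> y" "inv \<phi> (scale c x) = scale c (inv \<phi> x)" for x y c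
    by (metis add inv) (metis sc inv)
  thus "a \<in> dual scale \<Longrightarrow> a \<circ> inv \<phi> \<in> dual scale" "a \<in> dual scale \<Longrightarrow> a \<circ> \<phi> \<in> dual scale"
    by (simp_all add: dual_iff[OF vector_space_axioms] add sc)
qed

text \<open>
  The inverse transpose in \<open>beta\<close> is precomposition with the inverse of the linear part.
\<close>
lemma beta_apply:
  assumes \<phi>: "\<phi> \<in> GL scale UNIV" and a: "a \<in> dual scale"
  shows "beta scale (\<lambda>x. t + \<phi> x) (a\<^sub>0, a) = (a\<^sub>0 - a (inv \<phi> t), a \<circ> inv \<phi>)"
proof -
  have "transp \<phi> (a \<circ> inv \<phi>) = a" using inv_GL(1)[OF \<phi>] by (simp add: transp_def fun_eq_iff)
  hence "inv_into (dual scale) (transp \<phi>) a = a \<circ> inv \<phi>"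
    using bij_betw_transp[OF vector_space_axioms \<phi>] inv_GL(3)[OF \<phi> a]
    by (metis bij_betw_def inv_into_f_f)
  thus ?thesis
    using a by (simp add: beta_def affinity_parts[OF \<phi>, of "\<lambda>x. t + \<phi> x" t] FxDual_def)
qed

lemma beta_in_GL:
  assumes \<phi>: "\<phi> \<in> GL scale UNIV"
  shows "beta scale (\<lambda>x. t + \<phi> x) \<in> GL FxDual_scale (FxDual scale)"
proof -
  note [simp] = beta_apply[OF \<phi>] inv_GL[OF \<phi>]
  have [simp]: "a \<circ> inv \<phi> \<circ> \<phi> = a" "a \<circ> \<phi> \<circ> inv \<phi> = a" for a :: "'b \<Rightarrow> 'a"
    by (simp_all add: fun_eq_iff)
  have "bij_betw (beta scale (\<lambda>x. t + \<phi> x)) (FxDual scale) (FxDual scale)"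
    by (rule bij_betw_byWitness[where f' = "\<lambda>(b\<^sub>0, b). (b\<^sub>0 + b t, b \<circ> \<phi>)"])
      (auto simp: FxDual_def)
  moreover have "beta scale (\<lambda>x. t + \<phi> x) \<in> extensional (FxDual scale)"
    by (simp add: beta_def)
  moreover have "(\<lambda>x. c * a x) \<in> dual scale" "a + b \<in> dual scale"
    if "a \<in> dual scale" "b \<in> dual scale" for a b c
    using that by (auto simp: dual_iff[OF vector_space_axioms] algebra_simps)
  ultimately show ?thesis
    by (auto simp: GL_def FxDual_def FxDual_scale_def fun_eq_iff algebra_simps)
qed

lemma AGL_E:
  assumes "\<gamma> \<in> AGL scale"
  obtains t \<phi> where "\<phi> \<in> GL scale UNIV" "\<gamma> = (\<lambda>x. t + \<phi> x)" "linear_part \<gamma> = \<phi>"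
proof -
  obtain t \<phi> where \<phi>: "\<phi> \<in> GL scale UNIV" "\<And>x. \<gamma> x = t + \<phi> x" using assms by (auto simp: AGL_def)
  show ?thesis using that[OF \<phi>(1) ext[OF \<phi>(2)] affinity_parts(2)[OF \<phi>]] .
qed

lemma translation_in_weak_motion_group: "(\<lambda>x. t + x) \<in> weak_motion_group scale Q"
proof -
  have id: "(\<lambda>x. x) \<in> GL scale UNIV" by (simp add: GL_def bij_betw_def)
  have "linear_part (\<lambda>x. t + x) = (\<lambda>x. x)" using affinity_parts(2)[OF id] by simp
  thus ?thesis using id
    by (auto simp: weak_motion_group_def AGL_def weak_orthogonal_group_def orthogonal_group_def)
qed

lemma beta_translation:
  assumes "a \<in> dual scale"
  shows "beta scale (\<lambda>x. t + x) (a\<^sub>0, a) = (a\<^sub>0 - a t, a)"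
proof -
  have id: "(\<lambda>x. x) \<in> GL scale UNIV" by (simp add: GL_def bij_betw_def)
  have "inv (\<lambda>x::'b. x) = (\<lambda>x. x)" by (simp add: inv_equality)
  thus ?thesis using beta_apply[OF id assms, of t] by (simp add: comp_def)
qed

end

section \<open>Forms invariant up to scalars under translations\<close>

text \<open>
  The locale records what remains of the hypothesis on collineations when it is applied to the
  translations alone: some multiple of each represented translation is an isometry. The multiple is
  unknown because a collineation determines its linear map only up to a scalar.
\<close>
locale dual_quadric = vector_space s + W: quadratic_subspace FxDual_scale "FxDual s" q
  for s :: "'a::field \<Rightarrow> 'b::ab_group_add \<Rightarrow> 'b" and q :: "'a \<times> ('b \<Rightarrow> 'a) \<Rightarrow> 'a" +
  assumes translations_semi_isometric:
    "\<exists>c. \<forall>x\<in>FxDual s. q (FxDual_scale c (beta s (\<lambda>x. t + x) x)) = q x"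
begin

abbreviation apex :: "'a \<times> ('b \<Rightarrow> 'a)" where "apex \<equiv> (1, 0)"

lemma mem_FxDual [simp]: "(x\<^sub>0, a) \<in> FxDual s \<longleftrightarrow> a \<in> dual s"
  by (simp add: FxDual_def)

lemma zero_dual [simp]: "0 \<in> dual s"
  by (simp add: dual_iff[OF vector_space_axioms])

lemma FxDual_snd: "x \<in> FxDual s \<Longrightarrow> snd x \<in> dual s"
  by (cases x) simp

lemma snd_scale [simp]: "snd (FxDual_scale c x) v = c * snd x v"
  by (simp add: FxDual_scale_def)

text \<open>
  Since the translation by \<open>t\<close> sends \<open>x\<close> to \<open>x - snd x t \<cdot> apex\<close>, its effect on \<open>q\<close> is expressed by
  \<open>q apex\<close> and \<open>polar q x apex\<close>. The relations below compare \<open>q\<close> before and after the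
  translation at \<open>apex\<close>, at \<open>x\<close>, and (after polarisation) at the pair \<open>x\<close>, \<open>apex\<close>.
\<close>
lemma translation_relations:
  obtains c where "c\<^sup>2 * q apex = q apex"
    and "\<And>x. x \<in> FxDual s \<Longrightarrow>
           c\<^sup>2 * (q x + (snd x t)\<^sup>2 * q apex - snd x t * polar q x apex) = q x"
    and "\<And>x. x \<in> FxDual s \<Longrightarrow>
           c\<^sup>2 * (polar q x apex - 2 * snd x t * q apex) = polar q x apex"
proof -
  obtain c where c: "\<And>x. x \<in> FxDual s \<Longrightarrow> q (FxDual_scale c (beta s (\<lambda>x. t + x) x)) = q x"
    using translations_semi_isometric by blast
  define \<tau> where "\<tau> x = x + FxDual_scale (- snd x t) apex" for x :: "'a \<times> ('b \<Rightarrow> 'a)"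
  have \<tau>W: "\<tau> x \<in> FxDual s" if "x \<in> FxDual s" for x using that by (simp add: \<tau>_def)
  have "beta s (\<lambda>x. t + x) x = \<tau> x" if "x \<in> FxDual s" for x
    using that by (cases x) (simp add: beta_translation \<tau>_def FxDual_scale_def fun_eq_iff)
  hence inv: "c\<^sup>2 * q (\<tau> x) = q x" if "x \<in> FxDual s" for x
    using c[OF that] that \<tau>W W.form_scale by simp
  have q\<tau>: "q (\<tau> x) = q x + (snd x t)\<^sup>2 * q apex - snd x t * polar q x apex"
    if "x \<in> FxDual s" for x
    using that by (simp add: \<tau>_def W.form_add W.form_scale W.polar_scale_right del: W.scale_minus_left)
  have \<tau>e: "\<tau> apex = apex" by (simp add: \<tau>_def)
  have e: "c\<^sup>2 * q apex = q apex" using inv[of apex] \<tau>e by simp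
  have "c\<^sup>2 * (polar q x apex - 2 * snd x t * q apex) = polar q x apex"
    if x: "x \<in> FxDual s" for x
  proof -
    have "\<tau> (x + apex) = \<tau> x + apex" by (simp add: \<tau>_def algebra_simps)
    hence "c\<^sup>2 * (q (\<tau> x) + q apex + polar q (\<tau> x) apex) = q x + q apex + polar q x apex"
      using inv[of "x + apex"] x W.form_add by simp
    hence "c\<^sup>2 * polar q (\<tau> x) apex = polar q x apex"
      unfolding distrib_left inv[OF x] e by simp
    moreover have "polar q (\<tau> x) apex = polar q x apex - 2 * snd x t * q apex"
      using x by (simp add: \<tau>_def W.polar_add_left W.polar_scale_left W.polar_self
          del: W.scale_minus_left)
    ultimately show ?thesis by simp
  qed
  with e inv q\<tau> show ?thesis using that by metis
qed

text \<open>
  The relation at \<open>apex\<close> forces \<open>c\<^sup>2 = 1\<close>, and the other two relations then lose the unknown scalar.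
\<close>
lemma nonsingular_apex:
  assumes Q: "q apex \<noteq> 0" and a: "a \<in> dual s" "a t \<noteq> 0"
  shows "(2::'a) = 0" and "a t * q apex = polar q (0, a) apex"
proof -
  obtain c where c: "c\<^sup>2 * q apex = q apex"
    and 1: "\<And>x. x \<in> FxDual s \<Longrightarrow>
           c\<^sup>2 * (q x + (snd x t)\<^sup>2 * q apex - snd x t * polar q x apex) = q x"
    and 2: "\<And>x. x \<in> FxDual s \<Longrightarrow>
           c\<^sup>2 * (polar q x apex - 2 * snd x t * q apex) = polar q x apex"
    by (rule translation_relations[of t]) blast
  have c: "c\<^sup>2 = 1" using c Q by simp
  have "2 * a t * q apex = 0" using 2[of "(0,a)"] a c by simp
  thus "(2::'a) = 0" using Q a by simp
  have "a t * (a t * q apex) = a t * polar q (0, a) apex"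
    using 1[of "(0,a)"] a c by (simp add: power2_eq_square)
  thus "a t * q apex = polar q (0, a) apex" using a by simp
qed

text \<open>
  In \<open>nonsingular_apex\<close> the right-hand side does not depend on \<open>t\<close>. So a nonzero functional takes
  only one nonzero value, which is \<open>1\<close> after rescaling \<open>t\<close>, and \<open>polar q (0, a) apex = q apex\<close> for
  all nonzero \<open>a\<close>. This is incompatible with additivity in \<open>a\<close> as soon as \<open>a\<close>, \<open>b\<close> and
  \<open>a + b\<close> are all nonzero, and two distinct nonzero vectors supply such \<open>a\<close> and \<open>b\<close>.
\<close>
lemma nonsingular_apex_small:
  fixes v w :: 'b
  assumes Q: "q apex \<noteq> 0" and v: "v \<noteq> 0" "w \<noteq> 0"
  shows "v = w"
proof (rule ccontr)
  assume "v \<noteq> w"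
  obtain a where a: "a \<in> dual s" "a (v - w) = 1" using dual_separates[of "v - w"] \<open>v \<noteq> w\<close> by auto
  have one: "b t = 1" if b: "b \<in> dual s" "b t \<noteq> 0" for b t
  proof -
    have "b (s (1 / b t) t) = 1" using b by (simp add: dual_scale)
    hence "1 * q apex = polar q (0, b) apex" using nonsingular_apex(2)[OF Q b(1), of "s (1 / b t) t"] by simp
    thus ?thesis using nonsingular_apex(2)[OF Q b] Q by simp
  qed
  have pol: "polar q (0, b) apex = q apex" if b: "b \<in> dual s" "b t \<noteq> 0" for b t
    using nonsingular_apex(2)[OF Q b] one[OF b] by simp
  have False if x: "a x = 1" "a y = 0" "y \<noteq> 0" for x y
  proof -
    obtain b where b: "b \<in> dual s" "b y = 1" using dual_separates[OF x(3)] by auto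
    have ab: "a + b \<in> dual s" using a b by (simp add: dual_iff[OF vector_space_axioms] algebra_simps)
    have "(0, a + b) = (0::'a, a) + (0, b)" by simp
    hence "polar q (0, a + b) apex = polar q (0, a) apex + polar q (0, b) apex"
      using a b by (metis W.polar_add_left mem_FxDual zero_dual)
    hence "q apex = q apex + q apex"
      using pol[OF ab, of y] pol[OF a(1), of x] pol[OF b(1), of y] x b by simp
    thus False using Q by (metis add_cancel_right_right)
  qed
  moreover have "a v - a w = 1" using a dual_diff by simp
  hence "a v = 1 \<and> a w = 0 \<or> a w = 1 \<and> a v = 0"
    using one[OF a(1), of v] one[OF a(1), of w] by force
  ultimately show False using v by blast
qed

text \<open>
  If \<open>polar q x apex \<noteq> 0\<close>, the polarised relation gives \<open>c\<^sup>2 = 1\<close> for every translation, and then the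
  relation at \<open>x\<close> gives \<open>snd x t = 0\<close>. So \<open>x\<close> is a multiple of \<open>apex\<close>, which is
  orthogonal to itself.
\<close>
lemma singular_apex_in_radical:
  assumes Q: "q apex = 0"
  shows "apex \<in> radical (FxDual s) q"
proof -
  have "polar q x apex = 0" if x: "x \<in> FxDual s" for x
  proof (rule ccontr)
    assume B: "polar q x apex \<noteq> 0"
    have t: "snd x t = 0" for t
    proof -
      obtain c where
        1: "\<And>x. x \<in> FxDual s \<Longrightarrow>
             c\<^sup>2 * (q x + (snd x t)\<^sup>2 * q apex - snd x t * polar q x apex) = q x"
        and 2: "\<And>x. x \<in> FxDual s \<Longrightarrow>
             c\<^sup>2 * (polar q x apex - 2 * snd x t * q apex) = polar q x apex"
        by (rule translation_relations[of t]) blast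
      have "c\<^sup>2 = 1" using 2[OF x] Q B by simp
      thus ?thesis using 1[OF x] Q B by simp
    qed
    hence "x = FxDual_scale (fst x) apex" by (cases x) (auto simp: FxDual_scale_def fun_eq_iff)
    hence "polar q x apex = fst x * polar q apex apex"
      using W.polar_scale_left[of apex apex "fst x"] by simp
    thus False using B Q by (simp add: W.polar_self)
  qed
  thus ?thesis using W.polar_commute by (auto simp: radical_def)
qed

text \<open>
  Elements of the weak orthogonal group fix the radical vectorwise, whereas the vectors fixed by all
  translations are just the multiples of \<open>apex\<close>.
\<close>
lemma radical_eq_apex_line:
  assumes Q: "q apex = 0"
    and T: "\<And>t. beta s (\<lambda>x. t + x) \<in> weak_orthogonal_group FxDual_scale (FxDual s) q"
  shows "x \<in> radical (FxDual s) q \<longleftrightarrow> x \<in> FxDual s \<and> snd x = 0"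
proof
  assume x: "x \<in> radical (FxDual s) q"
  have "snd x t = 0" for t
    using T[of t] x by (cases x)
      (force simp: weak_orthogonal_group_def radical_def beta_translation FxDual_def)
  thus "x \<in> FxDual s \<and> snd x = 0" using x by (auto simp: radical_def)
next
  assume "x \<in> FxDual s \<and> snd x = 0"
  hence "x = FxDual_scale (fst x) apex" by (cases x) (auto simp: FxDual_scale_def fun_eq_iff)
  moreover have "FxDual_scale c apex \<in> radical (FxDual s) q" for c
    using singular_apex_in_radical[OF Q] by (simp add: radical_def W.polar_scale_left)
  ultimately show "x \<in> radical (FxDual s) q" by metis
qed

text \<open>
  Let \<open>r \<noteq> 0\<close> be in the radical of \<open>Q\<close>. The reflection in a nonsingular \<open>u\<close> comes from a map fixing \<open>r\<close>,
  which forces \<open>snd u r = 0\<close>; so \<open>q\<close> vanishes off the hyperplane \<open>snd u r = 0\<close>.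
  A nondegenerate form vanishes off a hyperplane only when \<open>F\<close> has two elements and the form on
  \<open>V\<^sup>*\<close> is a hyperbolic plane \<open>{0, a, b, a + b}\<close> with \<open>b\<close> its nonsingular vector. In that
  case \<open>V\<close> is spanned by \<open>r\<close> and one further vector \<open>w\<close>, and the polar form of \<open>Q\<close> is
  alternating with \<open>r\<close> in its radical, hence zero. Thus \<open>w\<close> lies in the radical too, and the
  reflection in \<open>b\<close>, which does not fix \<open>w\<close>, gives the contradiction.
\<close>
lemma weak_motions_imp_nondegenerate:
  assumes Q: "quadratic_form s UNIV Q"
    and apex: "q apex = 0"
    and H: "weak_orthogonal_group FxDual_scale (FxDual s) q = beta s ` weak_motion_group s Q"
  shows "radical UNIV Q = {0}"
proof -
  interpret Q: quadratic_subspace s UNIV Q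
    using Q by unfold_locales (auto simp: subspace_def)
  have rad: "x \<in> radical (FxDual s) q \<longleftrightarrow> x \<in> FxDual s \<and> snd x = 0" for x
    using radical_eq_apex_line[OF apex] translation_in_weak_motion_group by (simp add: H)
  have fixes_radical: "snd (\<kappa> x) r = snd x r"
    if r: "r \<in> radical UNIV Q" and \<kappa>: "\<kappa> \<in> weak_orthogonal_group FxDual_scale (FxDual s) q"
      and x: "x \<in> FxDual s" for \<kappa> x r
  proof -
    obtain \<gamma> where g: "\<kappa> = beta s \<gamma>" "\<gamma> \<in> AGL s" "linear_part \<gamma> \<in> weak_orthogonal_group s UNIV Q"
      using \<kappa> by (auto simp: H weak_motion_group_def)
    obtain t \<phi> where \<phi>: "\<phi> \<in> GL s UNIV" "\<gamma> = (\<lambda>x. t + \<phi> x)" "linear_part \<gamma> = \<phi>"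
      using AGL_E[OF g(2)] .
    have "\<phi> r = r" using g(3) r by (simp add: \<phi>(3) weak_orthogonal_group_def)
    hence "inv \<phi> r = r" using inv_GL(1)[OF \<phi>(1), of r] by simp
    thus ?thesis using x by (cases x) (simp add: g(1) \<phi>(2) beta_apply[OF \<phi>(1)])
  qed
  have refl_r: "polar q x u / q u * snd u r = 0"
    if r: "r \<in> radical UNIV Q" and u: "u \<in> FxDual s" "q u \<noteq> 0" and x: "x \<in> FxDual s" for r u x
    using fixes_radical[OF r W.reflection_weak_orthogonal[OF u] x] x
    by (simp add: W.reflection_def del: W.scale_minus_left)
  have singular: "q u = 0" if r: "r \<in> radical UNIV Q" and u: "u \<in> FxDual s" "snd u r \<noteq> 0" for r u
  proof (rule ccontr)
    assume qu: "q u \<noteq> 0"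
    have "u \<notin> radical (FxDual s) q" using rad u by auto
    then obtain x where "x \<in> FxDual s" "polar q x u \<noteq> 0"
      using u W.polar_commute by (auto simp: radical_def)
    thus False using refl_r[OF r u(1) qu] qu u by simp
  qed
  have "r = 0" if r: "r \<in> radical UNIV Q" for r
  proof (rule ccontr)
    assume "r \<noteq> 0"
    then obtain a where a: "a \<in> dual s" "a r = 1" using dual_separates by blast
    define u where "u = (0::'a, a)"
    have u: "u \<in> FxDual s" "snd u r = 1" "snd u = a" "q u = 0"
      using a singular[OF r, of u] by (auto simp: u_def)
    have "u \<notin> radical (FxDual s) q" using rad u by auto
    then obtain x where x: "x \<in> FxDual s" "polar q u x \<noteq> 0" using u by (auto simp: radical_def)
    \<comment> \<open>Subtracting a multiple of the singular vector \<open>u\<close> moves \<open>x\<close> into the hyperplane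
      without changing its product with \<open>u\<close>.\<close>
    define v where "v = x + FxDual_scale (- snd x r) u"
    have v: "v \<in> FxDual s" "snd v r = 0" using u x by (auto simp: v_def)
    have Buv: "polar q u v \<noteq> 0"
      using u x by (simp add: v_def W.polar_add_right W.polar_scale_right W.polar_self
          del: W.scale_minus_left)
    \<comment> \<open>The line \<open>u' + \<mu> v'\<close> stays off the hyperplane, so \<open>q\<close> vanishes along it.\<close>
    have scaled: "\<mu> * q v' = - polar q u' v'"
      if "u' \<in> FxDual s" "snd u' r = 1" "v' \<in> FxDual s" "snd v' r = 0" "\<mu> \<noteq> 0" for \<mu> u' v'
    proof -
      have "q (u' + FxDual_scale \<mu> v') = 0" "q u' = 0"
        using that by (auto intro!: singular[OF r])
      hence "\<mu> * (\<mu> * q v' + polar q u' v') = 0"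
        using that by (simp add: W.form_add W.form_scale W.polar_scale_right power2_eq_square
            algebra_simps)
      thus ?thesis using that by (simp add: eq_neg_iff_add_eq_0)
    qed
    \<comment> \<open>For the pair \<open>u\<close>, \<open>v\<close> the value \<open>\<mu> * q v\<close> is nonzero and the same for all \<open>\<mu> \<noteq> 0\<close>.\<close>
    have F2: "\<mu> = 1" if "\<mu> \<noteq> 0" for \<mu> :: 'a
    proof -
      have "\<mu> * q v = 1 * q v" using scaled[OF u(1,2) v that] scaled[OF u(1,2) v, of 1] by simp
      moreover have "q v \<noteq> 0" using scaled[OF u(1,2) v, of 1] Buv by auto
      ultimately show ?thesis by simp
    qed
    have neg: "- y = y" for y :: 'a
      using F2[of y] F2[of "- y"] by (cases "y = 0") auto
    have two: "y + y = 0" for y :: 'a using neg[of y] by (metis add.right_inverse)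
    have ker: "q z = polar q u' z"
      if "u' \<in> FxDual s" "snd u' r = 1" "z \<in> FxDual s" "snd z r = 0" for u' z
      using scaled[OF that, of 1] by (simp add: neg)
    have qv: "q v = 1" and Buv1: "polar q u v = 1" using F2 Buv ker[OF u(1,2) v] by auto
    \<comment> \<open>\<open>u\<close> and \<open>u + z'\<close> may both serve as \<open>u'\<close> in \<open>ker\<close>: the hyperplane is totally isotropic.\<close>
    have ker_polar: "polar q z z' = 0"
      if z: "z \<in> FxDual s" "snd z r = 0" and z': "z' \<in> FxDual s" "snd z' r = 0" for z z'
    proof -
      have "q z = polar q (u + z') z" using ker[of "u + z'" z] u z z' by simp
      also have "\<dots> = q z + polar q z' z" using ker[OF u(1,2) z] u z z' by (simp add: W.polar_add_left)
      finally show ?thesis using W.polar_commute by simp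
    qed
    \<comment> \<open>A singular vector of the hyperplane is orthogonal to the hyperplane and to \<open>u\<close>, hence to
      everything; so it is zero modulo \<open>apex\<close>.\<close>
    have ker_singular: "snd z = 0" if z: "z \<in> FxDual s" "snd z r = 0" "q z = 0" for z
    proof -
      have "polar q z x = 0" if x: "x \<in> FxDual s" for x
      proof -
        define x' where "x' = x + FxDual_scale (- snd x r) u"
        have x': "x' \<in> FxDual s" "snd x' r = 0" using u x by (auto simp: x'_def)
        have "x = x' + FxDual_scale (snd x r) u" by (simp add: x'_def)
        hence "polar q z x = polar q z x' + snd x r * polar q z u"
          using z x' u by (metis W.in_W(4) W.polar_add_right W.polar_scale_right)
        thus ?thesis using ker_polar[OF z(1,2) x'] ker[OF u(1,2) z(1,2)] z(3) W.polar_commute by simp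
      qed
      hence "z \<in> radical (FxDual s) q" using z by (simp add: radical_def)
      thus ?thesis by (simp only: rad)
    qed
    define b where "b = snd v"
    have b: "b \<in> dual s" using v FxDual_snd by (simp add: b_def)
    \<comment> \<open>All nonsingular vectors of the hyperplane agree modulo \<open>apex\<close>, as the sum of two of them is
      singular.\<close>
    have kerb: "snd z = 0 \<or> snd z = b" if z: "z \<in> FxDual s" "snd z r = 0" for z
    proof (cases "q z = 0")
      case True thus ?thesis using ker_singular z by blast
    next
      case False
      hence "q (z + v) = 0" using F2[of "q z"] qv ker_polar[OF z v] two[of 1] by (simp add: W.form_add)
      hence "snd (z + v) = 0" using ker_singular[of "z + v"] z v by simp
      hence "snd z y + b y = 0" for y by (simp add: b_def fun_eq_iff)
      hence "snd z y = b y" for y using neg[of "b y"] eq_neg_iff_add_eq_0 by metis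
      thus ?thesis by auto
    qed
    \<comment> \<open>\<open>V\<^sup>*\<close> is spanned by \<open>a\<close> and \<open>b\<close>.\<close>
    have sep: "y = y'" if y: "a y = a y'" "b y = b y'" for y y'
    proof (rule dual_separatesD)
      fix d assume d: "d \<in> dual s"
      define z where "z = (0, d) + FxDual_scale (- d r) u"
      have z: "z \<in> FxDual s" "snd z r = 0" using d u by (auto simp: z_def)
      have "d y = snd z y + d r * a y" for y using u by (simp add: z_def)
      moreover have "snd z y = snd z y'" using kerb[OF z] y by auto
      ultimately show "d y = d y'" using y by metis
    qed
    have br: "b r = 0" using v by (simp add: b_def)
    have "b \<noteq> 0" using rad[of v] v Buv W.polar_commute u by (auto simp: b_def radical_def)
    then obtain w where "b w \<noteq> 0" by (auto simp: fun_eq_iff)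
    hence w: "b w = 1" using F2 by simp
    have line: "y = 0 \<or> y = r" if "b y = 0" for y
      using sep[of y 0] sep[of y r] that br a b F2[of "a y"] dual_0[OF a(1)] dual_0[OF b] by auto
    have "polar Q w y = 0" for y
    proof -
      have rw: "polar Q w r = 0" "polar Q w 0 = 0"
        using r Q.polar_commute Q.polar_scale_right[of w w 0] by (auto simp: radical_def)
      have ww: "polar Q w w = 0" using Q.polar_self[of w] two[of 1] by simp
      show ?thesis
      proof (cases "b y = 0")
        case True thus ?thesis using line rw by blast
      next
        case False
        hence "b (y - w) = 0" using F2[of "b y"] w dual_diff[OF b] by simp
        from line[OF this] have "polar Q w (y - w) = 0"
          by (elim disjE) (simp_all only: rw)
        thus ?thesis using ww Q.polar_add_right[of "y - w" w w] by simp
      qed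
    qed
    hence "w \<in> radical UNIV Q" by (simp add: radical_def)
    hence "polar q u v / q v * snd v w = 0" using refl_r[of w v u] v u qv by simp
    thus False using qv Buv1 w by (simp add: b_def)
  qed
  moreover have "polar Q 0 y = 0" for y
    using Q.polar_scale_left[of 0 y 0] by simp
  hence "0 \<in> radical UNIV Q" by (simp add: radical_def)
  ultimately show ?thesis by blast
qed

text \<open>
  In the nonsingular case \<open>c\<^sup>2 = 1\<close>, which in characteristic \<open>2\<close> has the single solution \<open>c = 1\<close>.
\<close>
lemma fixes_apex:
  assumes char: "q apex \<noteq> 0 \<Longrightarrow> (2::'a) = 0"
    and \<kappa>: "\<kappa> \<in> weak_orthogonal_group FxDual_scale (FxDual s) q" "\<kappa> apex = FxDual_scale c apex"
  shows "c = 1"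
proof (cases "q apex = 0")
  case True
  hence "FxDual_scale c apex = apex"
    using singular_apex_in_radical \<kappa> by (auto simp: weak_orthogonal_group_def)
  thus ?thesis by (simp add: FxDual_scale_def)
next
  case False
  have "q (\<kappa> apex) = q apex"
    using \<kappa>(1) by (simp add: weak_orthogonal_group_def orthogonal_group_def)
  hence "c\<^sup>2 = 1" using False by (simp add: \<kappa>(2) W.form_scale)
  hence "(c - 1)\<^sup>2 = 0" using char[OF False] by (simp add: power2_diff)
  thus ?thesis by simp
qed

end

section \<open>Motion groups as weak orthogonal groups\<close>
lemma image_eq_imp_match: "f ` A = f ` B \<Longrightarrow> x \<in> A \<Longrightarrow> \<exists>y\<in>B. f x = f y"
  by (metis image_iff)

theorem theorem5p12:
  fixes s :: "'a::field \<Rightarrow> 'b::ab_group_add \<Rightarrow> 'b"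
    and Basis :: "'b set"
    and Q :: "'b \<Rightarrow> 'a"
    and Q' :: "'a \<times> ('b \<Rightarrow> 'a) \<Rightarrow> 'a"
  assumes "finite_dimensional_vector_space s Basis"
    and "quadratic_form s UNIV Q"
    and "quadratic_form FxDual_scale (FxDual s) Q'"
    and "induced_collineations FxDual_scale (FxDual s)
           (weak_orthogonal_group FxDual_scale (FxDual s) Q')
         \<in> {induced_collineations FxDual_scale (FxDual s) (beta s ` motion_group s Q),
            induced_collineations FxDual_scale (FxDual s) (beta s ` weak_motion_group s Q)}"
    and "\<not> (vector_space.dim s (UNIV :: 'b set) = 0 \<and> CHAR('a) \<noteq> 2 \<and> Q' ` FxDual s \<noteq> {0})"
  shows "beta s ` motion_group s Q = weak_orthogonal_group FxDual_scale (FxDual s) Q'"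
proof -
  interpret V: finite_dimensional_vector_space s Basis by fact
  interpret W: vector_space "FxDual_scale :: 'a \<Rightarrow> 'a \<times> ('b \<Rightarrow> 'a) \<Rightarrow> _"
    by (rule vector_space_FxDual_scale)
  note sub = subspace_FxDual[OF V.vector_space_axioms]
  let ?C = "collineation FxDual_scale (FxDual s)"
  let ?H = "weak_orthogonal_group FxDual_scale (FxDual s) Q'"
  have weak_sub: "weak_motion_group s Q \<subseteq> motion_group s Q"
    by (auto simp: weak_motion_group_def motion_group_def weak_orthogonal_group_def)
  obtain M where M: "M \<in> {motion_group s Q, weak_motion_group s Q}"
    and eq: "induced_collineations FxDual_scale (FxDual s) ?H =
      induced_collineations FxDual_scale (FxDual s) (beta s ` M)"
    using assms(4) by blast
  have eq: "?C ` ?H = ?C ` beta s ` M" using eq by (simp only: induced_collineations_def)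
  have H_to_G: "\<exists>g \<in> beta s ` M. ?C \<kappa> = ?C g" if "\<kappa> \<in> ?H" for \<kappa>
    by (rule image_eq_imp_match[OF eq that])
  have G_to_H: "\<exists>\<kappa>\<in>?H. ?C \<kappa> = ?C g" if "g \<in> beta s ` M" for g
    using image_eq_imp_match[OF eq[symmetric] that] by (simp only: eq_commute)
  have M_AGL: "M \<subseteq> AGL s" and weak_M: "weak_motion_group s Q \<subseteq> M"
    using M weak_sub by (auto simp: motion_group_def)
  have GL: "\<kappa> \<in> GL FxDual_scale (FxDual s)" if \<kappa>: "\<kappa> \<in> ?H \<union> beta s ` M" for \<kappa>
  proof (cases "\<kappa> \<in> ?H")
    case True
    thus ?thesis by (simp add: weak_orthogonal_group_def orthogonal_group_def)
  next
    case False
    then obtain \<gamma> where \<gamma>: "\<gamma> \<in> AGL s" "\<kappa> = beta s \<gamma>" using \<kappa> M_AGL by blast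
    obtain t \<phi> where "\<phi> \<in> GL s UNIV" "\<gamma> = (\<lambda>x. t + \<phi> x)" using V.AGL_E[OF \<gamma>(1)] .
    thus ?thesis using V.beta_in_GL by (simp only: \<gamma>(2))
  qed
  have scalar: "\<exists>c. c \<noteq> 0 \<and> (\<forall>x\<in>FxDual s. \<kappa> x = FxDual_scale c (g x))"
    if "\<kappa> \<in> ?H" "g \<in> beta s ` M" "?C \<kappa> = ?C g" for \<kappa> g
    using W.GL_collineation_eq_imp_scalar[OF sub] GL that by blast
  have "\<exists>c. \<forall>x\<in>FxDual s. Q' (FxDual_scale c (beta s (\<lambda>x. t + x) x)) = Q' x" for t
  proof -
    let ?\<tau> = "beta s (\<lambda>x. t + x)"
    have \<tau>: "?\<tau> \<in> beta s ` M" using V.translation_in_weak_motion_group weak_M by blast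
    then obtain \<kappa> where \<kappa>: "\<kappa> \<in> ?H" "?C \<kappa> = ?C ?\<tau>"
      using G_to_H by blast
    obtain c where c: "\<And>x. x \<in> FxDual s \<Longrightarrow> \<kappa> x = FxDual_scale c (?\<tau> x)"
      using scalar[OF \<kappa>(1) \<tau> \<kappa>(2)] by blast
    have "Q' (FxDual_scale c (?\<tau> x)) = Q' x" if "x \<in> FxDual s" for x
      using \<kappa>(1) that unfolding c[OF that, symmetric]
      by (simp add: weak_orthogonal_group_def orthogonal_group_def)
    thus ?thesis by blast
  qed
  then interpret dual_quadric s Q'
    using sub assms(3) by unfold_locales auto
  \<comment> \<open>For \<open>V = 0\<close> this is exactly what fails in the excluded exceptional case.\<close>
  have char: "(2::'a) = 0" if "Q' apex \<noteq> 0"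
  proof (cases "\<exists>t::'b. t \<noteq> 0")
    case True
    then obtain t a where "a \<in> dual s" "a t \<noteq> 0" using V.dual_separates by (metis one_neq_zero)
    thus ?thesis using nonsingular_apex(1) that by blast
  next
    case False
    hence "(UNIV :: 'b set) = {0}" by auto
    hence "V.dim (UNIV :: 'b set) = 0" using V.dim_singleton[of 0] by (simp only: if_True refl)
    moreover have "apex \<in> FxDual s" by simp
    hence "Q' ` FxDual s \<noteq> {0}" using that by blast
    ultimately have "CHAR('a) = 2" using assms(5) by blast
    thus ?thesis by (metis of_nat_CHAR of_nat_numeral)
  qed
  \<comment> \<open>Both maps send \<open>apex\<close> to a multiple of itself, and comparing these multiples determines the scalar.\<close>
  have same: "\<kappa> = g" if \<kappa>: "\<kappa> \<in> ?H" and g: "g \<in> beta s ` M"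
      and col: "?C \<kappa> = ?C g" for \<kappa> g
  proof -
    obtain c where c: "\<And>x. x \<in> FxDual s \<Longrightarrow> \<kappa> x = FxDual_scale c (g x)"
      using scalar[OF \<kappa> g col] by blast
    obtain \<gamma> where \<gamma>: "\<gamma> \<in> AGL s" "g = beta s \<gamma>" using g M_AGL by blast
    obtain t \<phi> where \<phi>: "\<phi> \<in> GL s UNIV" "\<gamma> = (\<lambda>x. t + \<phi> x)" using V.AGL_E[OF \<gamma>(1)] .
    have "g apex = apex" by (simp add: \<gamma>(2) \<phi>(2) V.beta_apply[OF \<phi>(1)] fun_eq_iff)
    hence "\<kappa> apex = FxDual_scale c apex" using c[of apex] by simp
    hence "c = 1" using fixes_apex[OF char \<kappa>] by blast
    hence "\<kappa> x = g x" if "x \<in> FxDual s" for x using c[OF that] by simp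
    moreover have "\<kappa> \<in> extensional (FxDual s)" "g \<in> extensional (FxDual s)"
      using GL[of \<kappa>] GL[of g] \<kappa> g unfolding GL_def by blast+
    ultimately show ?thesis by (rule extensionalityI[rotated 2])
  qed
  have H: "?H = beta s ` M"
  proof (intro equalityI subsetI)
    fix \<kappa> assume \<kappa>: "\<kappa> \<in> ?H"
    then obtain g where "g \<in> beta s ` M"
      "?C \<kappa> = ?C g"
      using H_to_G by blast
    thus "\<kappa> \<in> beta s ` M" using same \<kappa> by blast
  next
    fix g assume g: "g \<in> beta s ` M"
    then obtain \<kappa> where "\<kappa> \<in> ?H"
      "?C \<kappa> = ?C g"
      using G_to_H by blast
    thus "g \<in> ?H" using same g by blast
  qed
  have "motion_group s Q = weak_motion_group s Q" if weak: "M = weak_motion_group s Q"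
  proof -
    \<comment> \<open>Weakness is automatic: either the radical is zero or \<open>GL(V)\<close> is trivial.\<close>
    have "\<phi> x = x" if \<phi>: "\<phi> \<in> GL s UNIV" and x: "x \<in> radical UNIV Q" for \<phi> x
    proof -
      have \<phi>0: "\<phi> 0 = 0" using affinity_parts(1)[OF \<phi>, of \<phi> 0] by (simp add: trans_part_def)
      show ?thesis
      proof (cases "Q' apex = 0")
        case True
        hence "radical UNIV Q = {0}"
          using weak_motions_imp_nondegenerate[OF assms(2)] H unfolding weak by blast
        thus ?thesis using x \<phi>0 by simp
      next
        case False
        have "\<phi> x \<noteq> 0" if "x \<noteq> 0" using V.inv_GL(1)[OF \<phi>] \<phi>0 that by metis
        thus ?thesis using nonsingular_apex_small[OF False, of "\<phi> x" x] \<phi>0 by (cases "x = 0") auto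
      qed
    qed
    hence "orthogonal_group s UNIV Q = weak_orthogonal_group s UNIV Q"
      unfolding weak_orthogonal_group_def orthogonal_group_def by blast
    thus ?thesis by (simp only: motion_group_def weak_motion_group_def)
  qed
  thus ?thesis using H M by auto
qed

end
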